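(* Let $E$ be a finite set, let $m\ge1$, let $\varrho=(\varrho_1,\dots,\varrho_m)$ be a vector of positive integers, and let $\mathrm M^1,\dots,\mathrm M^m$ be initial flag matroids on the ground set $E$ of respective ranks $\varrho_1,\dots,\varrho_m$. For $i\in\{1,\dots,m\}$ and $j\in\{0,\dots,\varrho_i\}$, let $\mathrm M^i_j$ be the $j$-th constituent of $\mathrm M^i$. For $x\in Q_\varrho=\prod_{i=1}^m\{0,1,\dots,\varrho_i\}$, let $\mathrm M_x$ be the matroid union $\mathrm M^1_{x_1}\cup\dots\cup\mathrm M^m_{x_m}$, and let $\mathbf r(x)$ be the rank of the matroid $\mathrm M_x$. Then $\mathbf r:Q_\varrho\to\mathbb Z_{\ge0}$ is the rank function of a simple matricube with ground set $Q_\varrho$.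
   Context: An initial flag matroid of rank $s$ on $E$ is a collection of chains $F_0=\emptyset\subsetneq F_1\subsetneq\dots\subsetneq F_s\subseteq E$ with $|F_j|=j$ such that: for each $j=0,\dots,s$, the sets $F_j$ occurring in the chains of the collection form the set of bases of a matroid $\mathrm M_j$ of rank $j$ on $E$ (the $j$-th constituent); $\mathrm M_j$ is a quotient of $\mathrm M_{j+1}$ for each $0\le j<s$ (i.e. every flat of $\mathrm M_j$ is a flat of $\mathrm M_{j+1}$); and every chain $\emptyset=F_0\subset F_1\subset\dots\subset F_s$ with each $F_j$ a basis of $\mathrm M_j$ belongs to the collection. The independent sets of the matroid union $\mathrm M_x$ are the subsets of $E$ of the form $I_1\cup\dots\cup I_m$ with $I_i$ an independent set of $\mathrm M^i_{x_i}$. $Q_\varrho$ is ordered coordinatewise, $\vee$ and $\wedge$ are the coordinatewise maximum and minimum, and $e_i$ is the $i$-th unit vector. A matricube with ground set $Q_\varrho$ is given by a function $\mathbf r:Q_\varrho\to\mathbb Z$ (its rank function) such that: (R1) $\mathbf r(0)=0$ and $\mathbf r(t\,e_i)-\mathbf r((t-1)e_i)\le 1$ for all $1\le i\le m$ and $1\le t\le \varrho_i$; (R2) $x\preceq y$ implies $\mathbf r(x)\le\mathbf r(y)$; (R3) $\mathbf r(x)+\mathbf r(y)\ge \mathbf r(x\vee y)+\mathbf r(x\wedge y)$ for all $x,y\in Q_\varrho$. It is simple if $\varrho_i>0$ and $\mathbf r(t\,e_i)=t$ for all $i$ and all $t\in\{0,\dots,\varrho_i\}$. *)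

theory Defs
  imports Main
begin

text \<open>A matroid is given by its ground set and its family of independent sets.\<close>

locale matroid =
  fixes E :: "'a set" and \<I> :: "'a set set"
  assumes finite_ground: "finite E"
    and indep_subset_ground: "X \<in> \<I> \<Longrightarrow> X \<subseteq> E"
    and indep_empty: "{} \<in> \<I>"
    and indep_hereditary: "\<lbrakk>X \<in> \<I>; Y \<subseteq> X\<rbrakk> \<Longrightarrow> Y \<in> \<I>"
    and indep_augment: "\<lbrakk>X \<in> \<I>; Y \<in> \<I>; card X < card Y\<rbrakk> \<Longrightarrow> \<exists>y\<in>Y - X. insert y X \<in> \<I>"

definition bases :: "'a set set \<Rightarrow> 'a set set" where
  "bases \<I> = {B \<in> \<I>. \<forall>X\<in>\<I>. B \<subseteq> X \<longrightarrow> X = B}"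

definition rank_of :: "'a set set \<Rightarrow> 'a set \<Rightarrow> nat" where
  "rank_of \<I> X = Max (card ` {Y \<in> \<I>. Y \<subseteq> X})"

text \<open>The rank of a matroid is the rank of its ground set.\<close>

definition flats :: "'a set \<Rightarrow> 'a set set \<Rightarrow> 'a set set" where
  "flats E \<I> = {F. F \<subseteq> E \<and> (\<forall>x\<in>E - F. rank_of \<I> F < rank_of \<I> (insert x F))}"

definition matroid_quotient :: "'a set \<Rightarrow> 'a set set \<Rightarrow> 'a set set \<Rightarrow> bool" where
  "matroid_quotient E \<I> \<J> \<longleftrightarrow> flats E \<I> \<subseteq> flats E \<J>"

definition matroid_union :: "('i \<Rightarrow> 'a set set) \<Rightarrow> 'a set set" where
  "matroid_union \<I> = {(\<Union>i. X i) | X. \<forall>i. X i \<in> \<I> i}"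

text \<open>A chain \<open>F\<^sub>0 = {} \<subset> F\<^sub>1 \<subset> \<dots> \<subset> F\<^sub>s\<close> is encoded as the list of its members.\<close>

definition set_chain :: "nat \<Rightarrow> 'a set list \<Rightarrow> bool" where
  "set_chain s F \<longleftrightarrow> length F = Suc s \<and> F ! 0 = {} \<and> (\<forall>j<s. F ! j \<subset> F ! Suc j)"

definition members_at :: "'a set list set \<Rightarrow> nat \<Rightarrow> 'a set set" where
  "members_at C j = (\<lambda>F. F ! j) ` C"

text \<open>
  The \<open>j\<close>-th constituent is the matroid whose bases are the \<open>j\<close>-th members of the chains. By lemma
  \<open>matroid_determined_by_bases\<close> below, its independent sets can only be the subsets of these members.
\<close>

definition constituent :: "'a set list set \<Rightarrow> nat \<Rightarrow> 'a set set" where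
  "constituent C j = {X. \<exists>B\<in>members_at C j. X \<subseteq> B}"

definition initial_flag_matroid :: "'a set \<Rightarrow> nat \<Rightarrow> 'a set list set \<Rightarrow> bool" where
  "initial_flag_matroid E s C \<longleftrightarrow>
     (\<forall>F\<in>C. set_chain s F \<and> (\<forall>j\<le>s. F ! j \<subseteq> E \<and> card (F ! j) = j)) \<and>
     (\<forall>j\<le>s. matroid E (constituent C j) \<and>
             bases (constituent C j) = members_at C j \<and>
             rank_of (constituent C j) E = j) \<and>
     (\<forall>j<s. matroid_quotient E (constituent C j) (constituent C (Suc j))) \<and>
     (\<forall>F. set_chain s F \<and> (\<forall>j\<le>s. F ! j \<in> bases (constituent C j)) \<longrightarrow> F \<in> C)"

lemma matroid_determined_by_bases:
  assumes "matroid E \<I>"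
  shows "\<I> = {X. \<exists>B\<in>bases \<I>. X \<subseteq> B}"
proof -
  interpret matroid E \<I> by (rule assms)
  have "\<I> \<subseteq> Pow E"
    using indep_subset_ground by blast
  then have fin: "finite \<I>"
    using finite_ground by (simp add: finite_subset)
  show ?thesis
  proof (intro equalityI subsetI)
    fix X assume "X \<in> \<I>"
    from finite_has_maximal2[OF fin this]
    obtain B where B: "B \<in> \<I>" "X \<subseteq> B" "\<forall>Y\<in>\<I>. B \<subseteq> Y \<longrightarrow> B = Y" by metis
    then have "B \<in> bases \<I>" unfolding bases_def by fast
    with B(2) show "X \<in> {X. \<exists>B\<in>bases \<I>. X \<subseteq> B}" by (intro CollectI bexI)
  next
    fix X assume "X \<in> {X. \<exists>B\<in>bases \<I>. X \<subseteq> B}"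
    then obtain B where "B \<in> \<I>" "X \<subseteq> B" unfolding bases_def by fast
    then show "X \<in> \<I>" by (rule indep_hereditary)
  qed
qed

text \<open>
  The box \<open>\<Prod>\<^sub>i {0, \<dots>, \<rho> i}\<close> is the interval \<open>{..\<rho>}\<close> of the pointwise order on \<open>'i \<Rightarrow> nat\<close>, for a finite
  index type \<open>'i\<close>; there \<open>sup\<close> and \<open>inf\<close> are the coordinatewise maximum and minimum.
\<close>

definition axis_point :: "'i \<Rightarrow> nat \<Rightarrow> 'i \<Rightarrow> nat" where
  "axis_point i t = (\<lambda>_. 0)(i := t)"

text \<open>Only the values of \<open>r\<close> on the box \<open>{..\<rho>}\<close> are relevant.\<close>

locale matricube =
  fixes \<rho> :: "'i::finite \<Rightarrow> nat" and r :: "('i \<Rightarrow> nat) \<Rightarrow> int"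
  assumes R1_zero: "r (\<lambda>_. 0) = 0"
    and R1_step: "\<lbrakk>1 \<le> t; t \<le> \<rho> i\<rbrakk> \<Longrightarrow> r (axis_point i t) - r (axis_point i (t - 1)) \<le> 1"
    and R2: "\<lbrakk>x \<in> {..\<rho>}; y \<in> {..\<rho>}; x \<le> y\<rbrakk> \<Longrightarrow> r x \<le> r y"
    and R3: "\<lbrakk>x \<in> {..\<rho>}; y \<in> {..\<rho>}\<rbrakk> \<Longrightarrow> r (sup x y) + r (inf x y) \<le> r x + r y"

locale simple_matricube = matricube \<rho> r
  for \<rho> :: "'i::finite \<Rightarrow> nat" and r :: "('i \<Rightarrow> nat) \<Rightarrow> int" +
  assumes simple_pos: "0 < \<rho> i"
    and simple_axis: "t \<le> \<rho> i \<Longrightarrow> r (axis_point i t) = int t"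

end

theory Submission
  imports Defs
begin

text \<open>
  Let \<open>f x A = (\<Sum>i. r\<^sub>i A) + card (E - A)\<close>, where \<open>r\<^sub>i\<close> is the rank function of the constituent of index
  \<open>x i\<close> of the \<open>i\<close>-th flag matroid. By the rank formula for matroid unions
  (\<open>matroid_union_rank_le\<close>, \<open>matroid_union_rank_attained\<close>), the rank of the union is the minimum of
  \<open>f x A\<close> over all \<open>A \<subseteq> E\<close>. Submodularity of this minimum in \<open>x\<close> follows once \<open>f\<close> itself is submodular
  in both arguments together, provided that the subsets of \<open>E\<close> are ordered by reverse inclusion:
  \<open>f (sup x y) (A \<inter> B) + f (inf x y) (A \<union> B) \<le> f x A + f y B\<close>.
  This can be checked one coordinate at a time. If \<open>x i \<le> y i\<close>, the constituent of index \<open>x i\<close> is a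
  quotient of the one of index \<open>y i\<close>, so passing from \<open>A \<inter> B\<close> to \<open>B\<close> raises the rank in the larger
  constituent by at least as much as in the smaller one (\<open>quotient_rank_increment\<close>); there it raises
  it by at least as much as passing from \<open>A\<close> to \<open>A \<union> B\<close> does. The case \<open>y i \<le> x i\<close> is the same with the
  roles of \<open>A\<close> and \<open>B\<close> exchanged. Since the large index is paired with \<open>A \<inter> B\<close> in both cases, it does
  not matter that \<open>x\<close> and \<open>y\<close> may be incomparable.

  The hard half of the rank formula is a covering theorem (\<open>rado_cover\<close>): if every \<open>A \<subseteq> E\<close> satisfies
  \<open>card A \<le> (\<Sum>j. g j A)\<close> for monotone submodular functions \<open>g j\<close> with \<open>g j {} = 0\<close>, then \<open>E\<close> splits
  into parts, the \<open>j\<close>-th of which has at most as many elements as the value of \<open>g j\<close> on it. When \<open>g j\<close> is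
  a matroid rank function, such a part is independent.

  The remaining properties hold because the \<open>j\<close>-th members of the chains are contained in the
  \<open>(j + 1)\<close>-st ones, and because along the \<open>i\<close>-th axis the union is the constituent of index \<open>t\<close>, of rank
  \<open>t\<close>.
\<close>

section \<open>Rank functions of matroids\<close>

context matroid
begin

lemma finite_rank_candidates: "finite {Y \<in> \<I>. Y \<subseteq> X}"
proof -
  have "{Y \<in> \<I>. Y \<subseteq> X} \<subseteq> Pow E"
    using indep_subset_ground by blast
  then show ?thesis
    using finite_ground by (meson finite_Pow_iff finite_subset)
qed

lemma finite_indep: "X \<in> \<I> \<Longrightarrow> finite X"
  using indep_subset_ground finite_ground finite_subset by blast

lemma card_le_rank: "\<lbrakk>Y \<in> \<I>; Y \<subseteq> X\<rbrakk> \<Longrightarrow> card Y \<le> rank_of \<I> X"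
  unfolding rank_of_def using finite_rank_candidates by (intro Max_ge) auto

lemma rank_attained: "\<exists>Y\<in>\<I>. Y \<subseteq> X \<and> card Y = rank_of \<I> X"
proof -
  have "rank_of \<I> X \<in> card ` {Y \<in> \<I>. Y \<subseteq> X}"
    unfolding rank_of_def using finite_rank_candidates indep_empty by (intro Max_in) auto
  then show ?thesis by auto
qed

lemma rank_mono: "X \<subseteq> Y \<Longrightarrow> rank_of \<I> X \<le> rank_of \<I> Y"
  using rank_attained[of X] card_le_rank[of _ Y] by fastforce

lemma rank_empty: "rank_of \<I> {} = 0"
  using rank_attained[of "{}"] by auto

lemma indep_of_rank:
  assumes "finite X" "card X \<le> rank_of \<I> X"
  shows "X \<in> \<I>"
proof -
  obtain Y where "Y \<in> \<I>" "Y \<subseteq> X" "card Y = rank_of \<I> X"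
    using rank_attained by blast
  with assms have "Y = X"
    by (simp add: card_seteq)
  with \<open>Y \<in> \<I>\<close> show ?thesis by simp
qed

lemma indep_extends_to_rank:
  assumes "Y \<in> \<I>" "Y \<subseteq> X"
  shows "\<exists>Z\<in>\<I>. Y \<subseteq> Z \<and> Z \<subseteq> X \<and> card Z = rank_of \<I> X"
  using assms
proof (induction "rank_of \<I> X - card Y" arbitrary: Y)
  case 0
  then show ?case
    using card_le_rank[of Y X] by auto
next
  case (Suc n)
  obtain W where W: "W \<in> \<I>" "W \<subseteq> X" "card W = rank_of \<I> X"
    using rank_attained by blast
  have "card Y < card W"
    using Suc.hyps(2) W(3) by linarith
  then obtain y where y: "y \<in> W - Y" "insert y Y \<in> \<I>"
    using indep_augment[OF Suc.prems(1) W(1)] by blast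
  have n: "n = rank_of \<I> X - card (insert y Y)"
    using Suc.hyps(2) y(1) finite_indep[OF Suc.prems(1)] by simp
  have "insert y Y \<subseteq> X"
    using y(1) W(2) Suc.prems(2) by blast
  from Suc.hyps(1)[OF n y(2) this] show ?case by auto
qed

text \<open>
  A maximal independent subset \<open>A\<close> of \<open>X \<inter> Y\<close> extends to a maximal independent subset \<open>B\<close> of \<open>X \<union> Y\<close>. The
  traces of \<open>B\<close> on \<open>X\<close> and on \<open>Y\<close> are independent, cover \<open>B\<close>, and overlap in at least \<open>A\<close>.
\<close>

lemma rank_submodular:
  "rank_of \<I> (X \<union> Y) + rank_of \<I> (X \<inter> Y) \<le> rank_of \<I> X + rank_of \<I> Y"
proof -
  obtain A where A: "A \<in> \<I>" "A \<subseteq> X \<inter> Y" "card A = rank_of \<I> (X \<inter> Y)"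
    using rank_attained by blast
  then obtain B where B: "B \<in> \<I>" "A \<subseteq> B" "B \<subseteq> X \<union> Y" "card B = rank_of \<I> (X \<union> Y)"
    using indep_extends_to_rank[of A "X \<union> Y"] by blast
  note fin = finite_indep[OF B(1)]
  have "card B + card A \<le> card B + card (B \<inter> X \<inter> (B \<inter> Y))"
    using A(2) B(2) fin by (intro add_left_mono card_mono) auto
  also have "B = B \<inter> X \<union> B \<inter> Y"
    using B(3) by blast
  then have "card B + card (B \<inter> X \<inter> (B \<inter> Y)) = card (B \<inter> X) + card (B \<inter> Y)"
    using card_Un_Int[of "B \<inter> X" "B \<inter> Y"] fin by simp
  also have "\<dots> \<le> rank_of \<I> X + rank_of \<I> Y"
    using B(1) indep_hereditary by (intro add_mono card_le_rank) auto
  finally show ?thesis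
    using A(3) B(4) by simp
qed

lemma closure_is_flat:
  assumes "X \<subseteq> E"
  shows "{y \<in> E. rank_of \<I> (insert y X) = rank_of \<I> X} \<in> flats E \<I>" (is "?F \<in> _")
proof -
  have XF: "X \<subseteq> ?F"
    using assms by (auto simp: insert_absorb)
  have rank_F: "rank_of \<I> ?F = rank_of \<I> X"
  proof (rule ccontr)
    assume "\<not> ?thesis"
    then have less: "rank_of \<I> X < rank_of \<I> ?F"
      using rank_mono[OF XF] by simp
    obtain B where B: "B \<in> \<I>" "B \<subseteq> X" "card B = rank_of \<I> X"
      using rank_attained by blast
    obtain Z where Z: "Z \<in> \<I>" "Z \<subseteq> ?F" "card Z = rank_of \<I> ?F"
      using rank_attained by blast
    obtain y where y: "y \<in> Z - B" "insert y B \<in> \<I>"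
      using indep_augment[OF B(1) Z(1)] B(3) Z(3) less by auto
    have "card (insert y B) \<le> rank_of \<I> (insert y X)"
      using y(2) B(2) by (intro card_le_rank) auto
    moreover have "rank_of \<I> (insert y X) = rank_of \<I> X"
      using y(1) Z(2) by blast
    ultimately show False
      using y(1) B(3) finite_indep[OF B(1)] by simp
  qed
  have "rank_of \<I> ?F < rank_of \<I> (insert x ?F)" if "x \<in> E - ?F" for x
  proof -
    have "rank_of \<I> X < rank_of \<I> (insert x X)"
      using that rank_mono[of X "insert x X"] by fastforce
    also have "\<dots> \<le> rank_of \<I> (insert x ?F)"
      using XF by (intro rank_mono) blast
    finally show ?thesis
      using rank_F by simp
  qed
  then show ?thesis
    unfolding flats_def by blast
qed

lemma rank_insert_le: "rank_of \<I> (insert x X) \<le> Suc (rank_of \<I> X)"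
proof -
  obtain Y where Y: "Y \<in> \<I>" "Y \<subseteq> insert x X" "card Y = rank_of \<I> (insert x X)"
    using rank_attained by blast
  have "card (Y - {x}) \<le> rank_of \<I> X"
    using Y indep_hereditary[of Y "Y - {x}"] by (intro card_le_rank) auto
  then show ?thesis
    using Y(3) by (auto simp: card_Diff_singleton_if split: if_splits)
qed

end

section \<open>Quotients and rank increments\<close>

text \<open>
  An element that raises the rank of \<open>X\<close> in the quotient lies outside the closure \<open>F\<close> of \<open>X\<close> there.
  Now \<open>F\<close> is a flat of the larger matroid too, so there the element raises the rank of \<open>F\<close> and,
  increments being decreasing, also that of \<open>X \<subseteq> F\<close>.
\<close>

lemma quotient_rank_insert:
  assumes I: "matroid E \<I>" and J: "matroid E \<J>" and quot: "matroid_quotient E \<I> \<J>"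
    and X: "X \<subseteq> E" and e: "e \<in> E"
  shows "rank_of \<I> (insert e X) + rank_of \<J> X \<le> rank_of \<J> (insert e X) + rank_of \<I> X"
proof (cases "rank_of \<I> (insert e X) = rank_of \<I> X")
  case True
  then show ?thesis
    using matroid.rank_mono[OF J, of X "insert e X"] by auto
next
  case False
  define F where "F = {y \<in> E. rank_of \<I> (insert y X) = rank_of \<I> X}"
  have "F \<in> flats E \<J>"
    using matroid.closure_is_flat[OF I X] quot unfolding F_def matroid_quotient_def by blast
  moreover have eF: "e \<in> E - F"
    using False e unfolding F_def by simp
  ultimately have less: "rank_of \<J> F < rank_of \<J> (insert e F)"
    unfolding flats_def by blast
  have XF: "X \<subseteq> F"
    using X unfolding F_def by (auto simp: insert_absorb)
  have eqs: "F \<union> insert e X = insert e F" "F \<inter> insert e X = X"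
    using XF eF by auto
  have "rank_of \<J> X < rank_of \<J> (insert e X)"
    using matroid.rank_submodular[OF J, of F "insert e X"] less unfolding eqs by linarith
  then show ?thesis
    using matroid.rank_insert_le[OF I, of e X] by linarith
qed

text \<open>Adding the elements of \<open>Y - X\<close> one at a time reduces this to a single element.\<close>

lemma quotient_rank_increment:
  assumes I: "matroid E \<I>" and J: "matroid E \<J>" and quot: "matroid_quotient E \<I> \<J>"
    and XY: "X \<subseteq> Y" "Y \<subseteq> E"
  shows "rank_of \<I> Y + rank_of \<J> X \<le> rank_of \<J> Y + rank_of \<I> X"
proof -
  have "finite (Y - X)"
    using XY matroid.finite_ground[OF I] finite_subset by blast
  moreover have "Y - X \<subseteq> E"
    using XY by blast
  ultimately have "rank_of \<I> (X \<union> (Y - X)) + rank_of \<J> X \<le> rank_of \<J> (X \<union> (Y - X)) + rank_of \<I> X"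
  proof (induction rule: finite_subset_induct')
    case empty
    then show ?case by simp
  next
    case (insert e T)
    have "X \<union> T \<subseteq> E"
      using XY insert.hyps by auto
    from quotient_rank_insert[OF I J quot this] insert show ?case
      by fastforce
  qed
  moreover have "X \<union> (Y - X) = Y"
    using XY by blast
  ultimately show ?thesis by simp
qed

lemma constituent_matroid:
  "\<lbrakk>initial_flag_matroid E s C; j \<le> s\<rbrakk> \<Longrightarrow> matroid E (constituent C j)"
  unfolding initial_flag_matroid_def by blast

lemma rank_constituent:
  "\<lbrakk>initial_flag_matroid E s C; j \<le> s\<rbrakk> \<Longrightarrow> rank_of (constituent C j) E = j"
  unfolding initial_flag_matroid_def by blast

lemma constituent_mono:
  assumes C: "initial_flag_matroid E s C" and "j \<le> k" "k \<le> s"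
  shows "constituent C j \<subseteq> constituent C k"
  using \<open>j \<le> k\<close> \<open>k \<le> s\<close>
proof (induction rule: dec_induct)
  case (step n)
  have "set_chain s F" if "F \<in> C" for F
    using that C unfolding initial_flag_matroid_def by blast
  then have members: "F ! n \<subseteq> F ! Suc n" if "F \<in> C" for F
    using that step.prems unfolding set_chain_def by (simp add: psubset_imp_subset)
  have "constituent C n \<subseteq> constituent C (Suc n)"
  proof
    fix X assume "X \<in> constituent C n"
    then obtain F where "F \<in> C" "X \<subseteq> F ! n"
      unfolding constituent_def members_at_def by blast
    with members show "X \<in> constituent C (Suc n)"
      unfolding constituent_def members_at_def by (intro CollectI bexI[of _ "F ! Suc n"]) auto
  qed
  with step show ?case by auto
qed simp

lemma constituent_rank_increment:
  assumes C: "initial_flag_matroid E s C" and "j \<le> k" "k \<le> s" and XY: "X \<subseteq> Y" "Y \<subseteq> E"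
  shows "rank_of (constituent C j) Y + rank_of (constituent C k) X
    \<le> rank_of (constituent C k) Y + rank_of (constituent C j) X"
  using \<open>j \<le> k\<close> \<open>k \<le> s\<close>
proof (induction rule: dec_induct)
  case (step n)
  have "matroid_quotient E (constituent C n) (constituent C (Suc n))"
    using C step.prems unfolding initial_flag_matroid_def by simp
  then have "rank_of (constituent C n) Y + rank_of (constituent C (Suc n)) X
    \<le> rank_of (constituent C (Suc n)) Y + rank_of (constituent C n) X"
    using C step.prems XY by (intro quotient_rank_increment constituent_matroid) auto
  with step show ?case by simp
qed simp

text \<open>
  The rank in a flag matroid is submodular in index and set jointly, with sets ordered by reverse
  inclusion: the increment from adding a fixed set of elements grows with the index of the
  constituent, but shrinks as the set to which they are added grows.
\<close>

lemma flag_rank_submodular: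
  assumes C: "initial_flag_matroid E s C" and jk: "j \<le> s" "k \<le> s" and AB: "A \<subseteq> E" "B \<subseteq> E"
  shows "rank_of (constituent C (max j k)) (A \<inter> B) + rank_of (constituent C (min j k)) (A \<union> B)
    \<le> rank_of (constituent C j) A + rank_of (constituent C k) B"
proof -
  have ordered: "rank_of (constituent C k) (A \<inter> B) + rank_of (constituent C j) (A \<union> B)
    \<le> rank_of (constituent C j) A + rank_of (constituent C k) B"
    if "j \<le> k" "k \<le> s" "A \<subseteq> E" "B \<subseteq> E" for j k A B
    using constituent_rank_increment[OF C that(1,2), of "A \<inter> B" B] that
      matroid.rank_submodular[OF constituent_matroid[OF C, of j], of A B]
    by simp
  show ?thesis
    using ordered[of j k A B] ordered[of k j B A] jk AB
    by (cases "j \<le> k") (simp_all add: max_def min_def Int_commute Un_commute)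
qed

section \<open>The rank formula for matroid unions\<close>

text \<open>
  The family \<open>S\<close> records which indices each element may still choose: \<open>S j\<close> is the set of elements
  allowed to choose \<open>j\<close>. Choices are deleted one at a time, keeping the Hall-type condition, until every
  element has exactly one left. If an element \<open>e\<close> has two choices and neither deletion is possible, the sets \<open>A\<close> and \<open>B\<close> violating the
  condition after the two deletions both contain \<open>e\<close>. By submodularity their union and
  their intersection without \<open>e\<close> cannot both satisfy the original condition.
\<close>

lemma rado_cover:
  fixes g :: "'j::finite \<Rightarrow> 'a set \<Rightarrow> nat" and S :: "'j \<Rightarrow> 'a set"
  assumes "finite E" and "\<And>j. S j \<subseteq> E"
    and "\<And>A. A \<subseteq> E \<Longrightarrow> card A \<le> (\<Sum>j\<in>UNIV. g j (S j \<inter> A))"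
    and mono: "\<And>j A B. A \<subseteq> B \<Longrightarrow> g j A \<le> g j B"
    and empty: "\<And>j. g j {} = 0"
    and submod: "\<And>j A B. g j (A \<union> B) + g j (A \<inter> B) \<le> g j A + g j B"
  shows "\<exists>c. \<forall>j. card {e \<in> E. c e = j} \<le> g j {e \<in> E. c e = j}"
  using assms(2,3)
proof (induction "\<Sum>j\<in>UNIV. card (S j)" arbitrary: S rule: less_induct)
  case less
  note hall = less.prems(2)
  have fin: "finite A" if "A \<subseteq> E" for A
    using that \<open>finite E\<close> finite_subset by blast
  show ?case
  proof (cases "\<exists>e j k. j \<noteq> k \<and> e \<in> S j \<and> e \<in> S k")
    case True
    then obtain e j k where jk: "j \<noteq> k" "e \<in> S j" "e \<in> S k" by blast
    have eE: "e \<in> E"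
      using jk less.prems(1) by blast
    define del where "del i = S(i := S i - {e})" for i
    have smaller: "(\<Sum>l\<in>UNIV. card (del i l)) < (\<Sum>l\<in>UNIV. card (S l))" if "e \<in> S i" for i
    proof (rule sum_strict_mono_ex1)
      show "\<forall>l\<in>UNIV. card (del i l) \<le> card (S l)"
        using fin less.prems(1) unfolding del_def by (auto intro!: card_mono)
      have "card (del i i) < card (S i)"
        using card_Diff1_less[OF fin[OF less.prems(1)] that] unfolding del_def by simp
      then show "\<exists>l\<in>UNIV. card (del i l) < card (S l)" by blast
    qed simp
    show ?thesis
    proof (cases "\<exists>i. e \<in> S i \<and> (\<forall>A\<subseteq>E. card A \<le> (\<Sum>l\<in>UNIV. g l (del i l \<inter> A)))")
      case True
      then obtain i where i: "e \<in> S i" "\<And>A. A \<subseteq> E \<Longrightarrow> card A \<le> (\<Sum>l\<in>UNIV. g l (del i l \<inter> A))"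
        by blast
      have "del i l \<subseteq> E" for l
        using less.prems(1) unfolding del_def by auto
      from less.hyps[OF smaller[OF i(1)] this i(2)] show ?thesis .
    next
      case False
      have violated: "\<exists>A\<subseteq>E. e \<in> A \<and> (\<Sum>l\<in>UNIV. g l (del i l \<inter> A)) < card A" if i: "e \<in> S i" for i
      proof -
        obtain A where A: "A \<subseteq> E" "(\<Sum>l\<in>UNIV. g l (del i l \<inter> A)) < card A"
          using False i by (meson not_le)
        have "e \<in> A"
        proof (rule ccontr)
          assume "e \<notin> A"
          then have "del i l \<inter> A = S l \<inter> A" for l
            unfolding del_def by auto
          then show False
            using hall[OF A(1)] A(2) by simp
        qed
        with A show ?thesis by blast
      qed
      obtain A where A: "A \<subseteq> E" "e \<in> A" "(\<Sum>l\<in>UNIV. g l (del j l \<inter> A)) < card A"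
        using violated[OF jk(2)] by blast
      obtain B where B: "B \<subseteq> E" "e \<in> B" "(\<Sum>l\<in>UNIV. g l (del k l \<inter> B)) < card B"
        using violated[OF jk(3)] by blast
      have pointwise: "g l (S l \<inter> (A \<union> B)) + g l (S l \<inter> (A \<inter> B - {e}))
          \<le> g l (del j l \<inter> A) + g l (del k l \<inter> B)" for l
      proof -
        \<comment> \<open>Since \<open>j \<noteq> k\<close>, no index loses \<open>e\<close> in both deletions.\<close>
        have "S l \<inter> (A \<union> B) = (del j l \<inter> A) \<union> (del k l \<inter> B)"
          using jk(1) A(2) B(2) unfolding del_def by auto
        moreover have "S l \<inter> (A \<inter> B - {e}) \<subseteq> (del j l \<inter> A) \<inter> (del k l \<inter> B)"
          unfolding del_def by auto
        ultimately show ?thesis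
          using submod[of l "del j l \<inter> A" "del k l \<inter> B"]
            mono[of "S l \<inter> (A \<inter> B - {e})" "del j l \<inter> A \<inter> (del k l \<inter> B)" l]
          by simp
      qed
      have "card A + card B = card (A \<union> B) + Suc (card (A \<inter> B - {e}))"
        using card_Un_Int[OF fin[OF A(1)] fin[OF B(1)]]
          card_Suc_Diff1[of "A \<inter> B" e] A(2) B(2) fin[OF A(1)]
        by simp
      also have "card (A \<union> B) + Suc (card (A \<inter> B - {e}))
          \<le> (\<Sum>l\<in>UNIV. g l (S l \<inter> (A \<union> B))) + Suc (\<Sum>l\<in>UNIV. g l (S l \<inter> (A \<inter> B - {e})))"
        using A B by (intro add_mono iffD2[OF Suc_le_mono] hall) auto
      also have "\<dots> = Suc (\<Sum>l\<in>UNIV. g l (S l \<inter> (A \<union> B)) + g l (S l \<inter> (A \<inter> B - {e})))"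
        by (simp add: sum.distrib)
      also have "\<dots> \<le> Suc (\<Sum>l\<in>UNIV. g l (del j l \<inter> A) + g l (del k l \<inter> B))"
        using pointwise by (intro iffD2[OF Suc_le_mono] sum_mono) auto
      also have "\<dots> < card A + card B"
        using A(3) B(3) by (simp add: sum.distrib)
      finally show ?thesis by simp
    qed
  next
    case False
    have "\<exists>j. e \<in> S j" if "e \<in> E" for e
    proof (rule ccontr)
      assume "\<nexists>j. e \<in> S j"
      then show False
        using hall[of "{e}"] that empty by simp
    qed
    then obtain c where c: "\<And>e. e \<in> E \<Longrightarrow> e \<in> S (c e)"
      by metis
    have "card {e \<in> E. c e = j} \<le> g j {e \<in> E. c e = j}" for j
    proof -
      let ?A = "{e \<in> E. c e = j}"
      have "S l \<inter> ?A = (if l = j then ?A else {})" for l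
        using False c by auto
      then have "(\<Sum>l\<in>UNIV. g l (S l \<inter> ?A)) = (\<Sum>l\<in>UNIV. if l = j then g j ?A else 0)"
        using empty by (intro sum.cong) auto
      then show ?thesis
        using hall[of ?A] by simp
    qed
    then show ?thesis by blast
  qed
qed

lemma matroid_unionD_subset:
  assumes "\<And>i. matroid E (\<I> i)" "X \<in> matroid_union \<I>"
  shows "X \<subseteq> E"
  using assms matroid.indep_subset_ground unfolding matroid_union_def by fastforce

lemma finite_matroid_union:
  assumes "finite E" "\<And>i. matroid E (\<I> i)"
  shows "finite (matroid_union \<I>)"
  using matroid_unionD_subset[of E \<I>] assms
  by (meson PowI finite_Pow_iff finite_subset subsetI)

lemma empty_in_matroid_union:
  assumes "\<And>i. matroid E (\<I> i)"
  shows "{} \<in> matroid_union \<I>"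
  using matroid.indep_empty[OF assms] unfolding matroid_union_def
  by (intro CollectI exI[of _ "\<lambda>_. {}"]) auto

lemma card_le_rank_union:
  assumes "finite E" "\<And>i. matroid E (\<I> i)" "X \<in> matroid_union \<I>"
  shows "card X \<le> rank_of (matroid_union \<I>) E"
  unfolding rank_of_def
  using finite_matroid_union[of E \<I>] assms
    matroid_unionD_subset[OF assms(2,3)]
  by (intro Max_ge) auto

lemma rank_union_leI:
  assumes "finite E" "\<And>i. matroid E (\<I> i)" "\<And>X. X \<in> matroid_union \<I> \<Longrightarrow> card X \<le> n"
  shows "rank_of (matroid_union \<I>) E \<le> n"
  unfolding rank_of_def
  using finite_matroid_union[of E \<I>] empty_in_matroid_union[of E \<I>] assms
  by (subst Max_le_iff) auto

text \<open>
  In a union of independent sets, the elements inside \<open>A\<close> are covered by the traces of the members on \<open>A\<close>;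
  those outside number at most \<open>card (E - A)\<close>.
\<close>

lemma matroid_union_rank_le:
  fixes \<I> :: "'i::finite \<Rightarrow> 'a set set"
  assumes "finite E" and I: "\<And>i. matroid E (\<I> i)"
  shows "rank_of (matroid_union \<I>) E \<le> (\<Sum>i\<in>UNIV. rank_of (\<I> i) A) + card (E - A)"
proof (rule rank_union_leI[OF assms])
  fix X assume XU: "X \<in> matroid_union \<I>"
  then obtain Y where Y: "X = (\<Union>i. Y i)" "\<And>i. Y i \<in> \<I> i"
    unfolding matroid_union_def by blast
  have XE: "X \<subseteq> E"
    using matroid_unionD_subset[OF I XU] .
  have "card X \<le> card (X \<inter> A) + card (X - A)"
    using card_Un_le[of "X \<inter> A" "X - A"] by (simp add: Int_Diff_Un)
  also have "card (X - A) \<le> card (E - A)"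
    using XE \<open>finite E\<close> by (intro card_mono) auto
  also have "X \<inter> A = (\<Union>i. Y i \<inter> A)"
    using Y(1) by blast
  also have "card (\<Union>i. Y i \<inter> A) \<le> (\<Sum>i\<in>UNIV. card (Y i \<inter> A))"
    by (rule card_UN_le) simp
  also have "\<dots> \<le> (\<Sum>i\<in>UNIV. rank_of (\<I> i) A)"
    using Y(2) matroid.indep_hereditary[OF I]
    by (intro sum_mono matroid.card_le_rank[OF I]) (blast, simp)
  finally show "card X \<le> (\<Sum>i\<in>UNIV. rank_of (\<I> i) A) + card (E - A)"
    by simp
qed

text \<open>
  Let \<open>d\<close> be the minimum of the left-hand side over all \<open>A \<subseteq> E\<close>. Adding the uniform matroid of rank \<open>card E - d\<close> as an extra member of the
  family makes the hypothesis of the covering theorem hold with all choices allowed; the part of \<open>E\<close> assigned to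
  this extra member (index \<open>None\<close>) has at most \<open>card E - d\<close> elements, which leaves at least \<open>d\<close> for the
  others.
\<close>

lemma matroid_union_rank_attained:
  fixes \<I> :: "'i::finite \<Rightarrow> 'a set set"
  assumes "finite E" and I: "\<And>i. matroid E (\<I> i)"
  shows "\<exists>A\<subseteq>E. (\<Sum>i\<in>UNIV. rank_of (\<I> i) A) + card (E - A) \<le> rank_of (matroid_union \<I>) E"
proof -
  define f where "f A = (\<Sum>i\<in>UNIV. rank_of (\<I> i) A) + card (E - A)" for A
  define d where "d = Min (f ` Pow E)"
  have fin: "finite (f ` Pow E)"
    using \<open>finite E\<close> by simp
  have "d \<in> f ` Pow E"
    unfolding d_def using fin by (intro Min_in) auto
  then obtain A where A: "A \<subseteq> E" "f A = d"
    by blast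
  have d_le: "d \<le> f B" if "B \<subseteq> E" for B
    unfolding d_def using fin that by (intro Min_le) auto
  have "f {} = card E"
    unfolding f_def using matroid.rank_empty[OF I] by simp
  then have d_card: "d \<le> card E"
    using d_le[of "{}"] by simp
  define g where "g j B = (case j of None \<Rightarrow> min (card (B \<inter> E)) (card E - d) | Some i \<Rightarrow> rank_of (\<I> i) B)"
    for j :: "'i option" and B
  have sum_g: "(\<Sum>j\<in>UNIV. g j B) = min (card (B \<inter> E)) (card E - d) + (\<Sum>i\<in>UNIV. rank_of (\<I> i) B)" for B
    by (simp add: UNIV_option_conv sum.reindex g_def)
  have "\<exists>c. \<forall>j. card {e \<in> E. c e = j} \<le> g j {e \<in> E. c e = j}"
  proof (rule rado_cover[OF \<open>finite E\<close>, where S = "\<lambda>_. E"])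
    fix B assume B: "B \<subseteq> E"
    have "card (E - B) + card B = card E"
      using B \<open>finite E\<close> by (simp add: card_Diff_subset finite_subset card_mono)
    then have "card B \<le> min (card B) (card E - d) + (\<Sum>i\<in>UNIV. rank_of (\<I> i) B)"
      using d_le[OF B] unfolding f_def by linarith
    then have "card B \<le> (\<Sum>j\<in>UNIV. g j B)"
      using B unfolding sum_g by (simp add: Int_absorb2)
    then show "card B \<le> (\<Sum>j\<in>UNIV. g j (E \<inter> B))"
      using B by (simp add: Int_absorb1)
  next
    fix j and B D :: "'a set" assume "B \<subseteq> D"
    then have "card (B \<inter> E) \<le> card (D \<inter> E)"
      using \<open>finite E\<close> by (intro card_mono) auto
    then show "g j B \<le> g j D"
      using matroid.rank_mono[OF I \<open>B \<subseteq> D\<close>] by (auto simp: g_def split: option.split)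
  next
    fix j and B D :: "'a set"
    have "card ((B \<union> D) \<inter> E) + card (B \<inter> D \<inter> E) = card (B \<inter> E) + card (D \<inter> E)"
      using card_Un_Int[of "B \<inter> E" "D \<inter> E"] \<open>finite E\<close>
      by (simp add: Int_Un_distrib2 Int_assoc Int_left_commute Int_commute[of E])
    moreover have "card (B \<inter> E) \<le> card ((B \<union> D) \<inter> E)" "card (D \<inter> E) \<le> card ((B \<union> D) \<inter> E)"
      using \<open>finite E\<close> by (auto intro!: card_mono)
    ultimately show "g j (B \<union> D) + g j (B \<inter> D) \<le> g j B + g j D"
      using matroid.rank_submodular[OF I] by (auto simp: g_def split: option.split)
  qed (auto simp: g_def matroid.rank_empty[OF I] split: option.split)
  then obtain c where c: "\<And>j. card {e \<in> E. c e = j} \<le> g j {e \<in> E. c e = j}"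
    by blast
  have "{e \<in> E. c e = Some i} \<in> \<I> i" for i
    using c[of "Some i"] \<open>finite E\<close> by (intro matroid.indep_of_rank[OF I]) (simp_all add: g_def)
  then have "(\<Union>i. {e \<in> E. c e = Some i}) \<in> matroid_union \<I>"
    unfolding matroid_union_def by blast
  moreover have "(\<Union>i. {e \<in> E. c e = Some i}) = E - {e \<in> E. c e = None}"
    by auto
  ultimately have "card (E - {e \<in> E. c e = None}) \<le> rank_of (matroid_union \<I>) E"
    using card_le_rank_union[of E \<I>, OF \<open>finite E\<close> I] by metis
  moreover have "card {e \<in> E. c e = None} \<le> card E - d"
    using c[of None] by (simp add: g_def)
  then have "d \<le> card (E - {e \<in> E. c e = None})"
    using d_card \<open>finite E\<close> by (simp add: card_Diff_subset)
  ultimately show ?thesis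
    using A unfolding f_def by auto
qed

section \<open>The matricube of a family of flag matroids\<close>

theorem theorem2p9:
  fixes E :: "'a set"
    and \<rho> :: "'i::finite \<Rightarrow> nat"
    and M :: "'i \<Rightarrow> 'a set list set"
  assumes "finite E"
    and "\<And>i. 0 < \<rho> i"
    and "\<And>i. initial_flag_matroid E (\<rho> i) (M i)"
  shows "simple_matricube \<rho> (\<lambda>x. int (rank_of (matroid_union (\<lambda>i. constituent (M i) (x i))) E))"
proof -
  define U where "U x = matroid_union (\<lambda>i. constituent (M i) (x i))" for x
  note flag = assms(3)
  have matroids: "matroid E (constituent (M i) (x i))" if "x \<in> {..\<rho>}" for x i
    using that constituent_matroid[OF flag] by (simp add: le_fun_def)
  have axis: "rank_of (U (axis_point i t)) E = t" if t: "t \<le> \<rho> i" for i t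
  proof (rule antisym)
    have box: "axis_point i t \<in> {..\<rho>}"
      using t by (auto simp: axis_point_def le_fun_def)
    \<comment> \<open>The upper bound is the union rank formula at \<open>A = E\<close>, where each summand is a coordinate.\<close>
    have "rank_of (U (axis_point i t)) E
        \<le> (\<Sum>l\<in>UNIV. rank_of (constituent (M l) (axis_point i t l)) E) + card (E - E)"
      unfolding U_def by (rule matroid_union_rank_le[OF \<open>finite E\<close> matroids[OF box]])
    also have "\<dots> = (\<Sum>l\<in>UNIV. axis_point i t l)"
      using box by (simp add: rank_constituent[OF flag] le_fun_def)
    also have "\<dots> = t"
      by (simp add: axis_point_def fun_upd_def)
    finally show "rank_of (U (axis_point i t)) E \<le> t" .
    obtain Y where Y: "Y \<in> constituent (M i) t" "card Y = t"
      using matroid.rank_attained[OF constituent_matroid[OF flag t], of E]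
        rank_constituent[OF flag t] by auto
    have "Y = (\<Union>l. if l = i then Y else {})"
      by auto
    moreover have "(if l = i then Y else {}) \<in> constituent (M l) (axis_point i t l)" for l
      using Y(1) matroid.indep_empty[OF matroids[OF box, of l]]
      by (cases "l = i") (simp_all add: axis_point_def)
    ultimately have "Y \<in> U (axis_point i t)"
      unfolding U_def matroid_union_def by (intro CollectI exI[of _ "\<lambda>l. if l = i then Y else {}"]) blast
    then show "t \<le> rank_of (U (axis_point i t)) E"
      using card_le_rank_union[of E "\<lambda>l. constituent (M l) (axis_point i t l)" Y] matroids[OF box]
        \<open>finite E\<close> Y(2) unfolding U_def by simp
  qed
  have mono: "rank_of (U x) E \<le> rank_of (U y) E" if "x \<in> {..\<rho>}" "y \<in> {..\<rho>}" "x \<le> y" for x y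
  proof -
    have "constituent (M i) (x i) \<subseteq> constituent (M i) (y i)" for i
      using constituent_mono[OF flag] that by (simp add: le_fun_def)
    then have "U x \<subseteq> U y"
      unfolding U_def matroid_union_def by blast
    then have "card X \<le> rank_of (U y) E" if "X \<in> U x" for X
      using that matroids[OF \<open>y \<in> {..\<rho>}\<close>] unfolding U_def
      by (intro card_le_rank_union[OF \<open>finite E\<close>]) auto
    then show ?thesis
      using matroids[OF \<open>x \<in> {..\<rho>}\<close>] unfolding U_def
      by (intro rank_union_leI[OF \<open>finite E\<close>]) auto
  qed
  have submod: "rank_of (U (sup x y)) E + rank_of (U (inf x y)) E \<le> rank_of (U x) E + rank_of (U y) E"
    if x: "x \<in> {..\<rho>}" and y: "y \<in> {..\<rho>}" for x y
  proof -
    define f where "f z A = (\<Sum>i\<in>UNIV. rank_of (constituent (M i) (z i)) A) + card (E - A)" for z A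
    have upper: "rank_of (U z) E \<le> f z A" if "z \<in> {..\<rho>}" for z A
      unfolding U_def f_def by (rule matroid_union_rank_le[OF \<open>finite E\<close> matroids[OF that]])
    have lower: "\<exists>A\<subseteq>E. f z A \<le> rank_of (U z) E" if "z \<in> {..\<rho>}" for z
      unfolding U_def f_def by (rule matroid_union_rank_attained[OF \<open>finite E\<close> matroids[OF that]])
    obtain A B where A: "A \<subseteq> E" "f x A \<le> rank_of (U x) E" and B: "B \<subseteq> E" "f y B \<le> rank_of (U y) E"
      using lower[OF x] lower[OF y] by blast
    have box: "sup x y \<in> {..\<rho>}" "inf x y \<in> {..\<rho>}"
      using x y by (simp_all add: le_infI1)
    have "card (E - A \<inter> B) + card (E - (A \<union> B)) = card (E - A) + card (E - B)"
      using card_Un_Int[of "E - A" "E - B"] \<open>finite E\<close> by (simp add: Diff_Int Diff_Un)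
    moreover have "(\<Sum>i\<in>UNIV. rank_of (constituent (M i) (sup x y i)) (A \<inter> B)
          + rank_of (constituent (M i) (inf x y i)) (A \<union> B))
        \<le> (\<Sum>i\<in>UNIV. rank_of (constituent (M i) (x i)) A + rank_of (constituent (M i) (y i)) B)"
      using flag_rank_submodular[OF flag _ _ A(1) B(1)] x y
      by (intro sum_mono) (simp add: sup_max inf_min le_fun_def)
    ultimately have "f (sup x y) (A \<inter> B) + f (inf x y) (A \<union> B) \<le> f x A + f y B"
      unfolding f_def by (simp add: sum.distrib)
    then show ?thesis
      using upper[OF box(1), of "A \<inter> B"] upper[OF box(2), of "A \<union> B"] A(2) B(2) by linarith
  qed
  have "(\<lambda>_. 0) = axis_point i 0" for i :: 'i
    by (auto simp: axis_point_def)
  then have "rank_of (U (\<lambda>_. 0)) E = 0"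
    using axis[of 0] by simp
  with axis mono submod assms(2) have "simple_matricube \<rho> (\<lambda>x. int (rank_of (U x) E))"
    by unfold_locales (simp_all flip: of_nat_add)
  then show ?thesis
    unfolding U_def by simp
qed

end
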